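(* For all integers $n\geq 2$ and $k\geq 1$ we have $p_{n,k+1,1}>p_{n,k,1}$. That is, the probability that at least one of $n$ passengers is lonely when each independently boards one of $k+1$ buses uniformly at random is strictly greater than the corresponding probability with $k$ buses.
   Context: For integers $n\geq 2$ and $k\geq 1$, suppose $n$ passengers board $k$ buses, each passenger independently choosing one of the $k$ buses uniformly at random. A passenger is called lonely if no other passenger boards the same bus. Let the random variable $L^{(k)}_n$ be the number of lonely passengers when $n$ passengers board $k$ buses in this way, and write $p_{n,k,r}=\mathbb P(L^{(k)}_n\geq r)$. *)

theory Defs
  imports "HOL-Probability.Probability"
begin

text \<open>
  Passengers are \<open>{..<n}\<close> and buses are \<open>{..<k}\<close>; a boarding is a function \<open>f\<close> sending passenger
  \<open>i < n\<close> to the bus \<open>f i\<close>. Its values \<open>f i\<close> for \<open>i \<ge> n\<close> are the irrelevant default \<open>0\<close> of the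
  product distribution. The distribution is meaningful only for \<open>k \<ge> 1\<close>, because
  \<^const>\<open>pmf_of_set\<close> is unspecified on the empty set.
\<close>

definition boarding :: "nat \<Rightarrow> nat \<Rightarrow> (nat \<Rightarrow> nat) pmf" where
  "boarding n k = Pi_pmf {..<n} 0 (\<lambda>_. pmf_of_set {..<k})"

definition lonely :: "nat \<Rightarrow> (nat \<Rightarrow> nat) \<Rightarrow> nat \<Rightarrow> bool" where
  "lonely n f i \<longleftrightarrow> i < n \<and> (\<forall>j<n. j \<noteq> i \<longrightarrow> f j \<noteq> f i)"

definition num_lonely :: "nat \<Rightarrow> (nat \<Rightarrow> nat) \<Rightarrow> nat" where
  "num_lonely n f = card {i. lonely n f i}"

definition lonely_prob :: "nat \<Rightarrow> nat \<Rightarrow> nat \<Rightarrow> real" where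
  "lonely_prob n k r = measure_pmf.prob (boarding n k) {f. num_lonely n f \<ge> r}"

end

theory Submission
  imports Defs "HOL-Computational_Algebra.Formal_Power_Series"
begin

text \<open>
  Let \<open>q n k\<close> be the probability that nobody is lonely; it is \<open>n! / k^n\<close> times the coefficient of
  \<open>x^n\<close> in \<open>(exp x - x)^k\<close>. Suppose \<open>q n (k + 1) \<ge> q n k\<close>. The number \<open>i\<close> of passengers avoiding the
  last of \<open>k + 1\<close> buses is binomially distributed; conditioning on the event that nobody is lonely
  multiplies its distribution by \<open>R i = q i k / q n (k + 1)\<close> (by \<open>0\<close> if \<open>i = n - 1\<close>) and, by symmetry
  of the buses, does not change its mean. Hence \<open>R - 1\<close> is orthogonal to every affine function of
  \<open>i\<close>. Testing against \<open>i - s\<close> gives a contradiction as soon as \<open>R i \<le> 1\<close> for all \<open>i > s\<close> and the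
  loss at \<open>i = n - 1\<close> outweighs the tail \<open>i < s\<close> of the unconditioned binomial distribution. For
  \<open>n \<le> k + 2\<close> one takes \<open>s = n - 2\<close>, where the first condition is immediate. For \<open>n \<ge> k + 2\<close> one takes
  \<open>s = k\<close>; there \<open>R i \<le> 1\<close> because \<open>q i k\<close> increases in \<open>i\<close> for \<open>i > k\<close>, which amounts to the
  coefficients of \<open>(1 - x) (exp x - x)^k\<close> being nonpositive from index \<open>k + 2\<close> on.
\<close>

subsection \<open>Coefficients of powers of \<open>exp x - x\<close>\<close>

text \<open>Exponential generating function for a single bus that may carry any number of passengers
  except exactly one.\<close>

definition nonlonely_fps :: "real fps" where
  "nonlonely_fps = fps_exp 1 - fps_X"

definition nl_coeff :: "nat \<Rightarrow> nat \<Rightarrow> real" where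
  "nl_coeff k n = fps_nth (nonlonely_fps ^ k) n"

text \<open>The factor \<open>1 - fps_X\<close> takes successive differences of coefficients, and it
  also equals \<open>nonlonely_fps\<close> minus its derivative; the recurrences come from combining
  both roles.\<close>

definition nl_diff :: "nat \<Rightarrow> nat \<Rightarrow> real" where
  "nl_diff k n = fps_nth ((1 - fps_X) * nonlonely_fps ^ k) n"

lemma nonlonely_fps_nth: "fps_nth nonlonely_fps j = (if j = 1 then 0 else 1 / fact j)"
  by (simp add: nonlonely_fps_def fps_X_def)

lemma nl_coeff_0: "nl_coeff 0 n = (if n = 0 then 1 else 0)"
  by (simp add: nl_coeff_def)

lemma nl_coeff_1: "nl_coeff (Suc 0) n = (if n = 1 then 0 else 1 / fact n)"
  by (simp add: nl_coeff_def nonlonely_fps_nth)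

lemma nl_coeff_Suc:
  "nl_coeff (Suc k) n = (\<Sum>i\<le>n. nl_coeff k i * fps_nth nonlonely_fps (n - i))"
  by (simp add: nl_coeff_def fps_mult_nth power_Suc2 atMost_atLeast0 del: power_Suc)

lemma nl_coeff_nonneg: "nl_coeff k n \<ge> 0"
proof (induction k arbitrary: n)
  case (Suc k)
  then show ?case
    by (auto simp: nl_coeff_Suc nonlonely_fps_nth intro!: sum_nonneg)
qed (simp add: nl_coeff_0)

lemma nl_diff_0: "nl_diff k 0 = nl_coeff k 0"
  by (simp add: nl_diff_def nl_coeff_def left_diff_distrib)

lemma nl_diff_Suc: "nl_diff k (Suc n) = nl_coeff k (Suc n) - nl_coeff k n"
  by (simp add: nl_diff_def nl_coeff_def left_diff_distrib)

section \<open>Recurrences from differentiating the power\<close>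

lemma deriv_nonlonely_fps: "fps_deriv nonlonely_fps = nonlonely_fps - (1 - fps_X)"
  by (simp add: nonlonely_fps_def)

lemma deriv_power_nonlonely_fps:
  "fps_deriv (nonlonely_fps ^ Suc k) =
     fps_const (real (Suc k)) * (nonlonely_fps ^ k * fps_deriv nonlonely_fps)"
  by (simp add: fps_deriv_power mult_ac del: power_Suc of_nat_Suc)

lemma nl_coeff_rec:
  "real (Suc n) * nl_coeff (Suc k) (Suc n) = real (Suc k) * (nl_coeff (Suc k) n - nl_diff k n)"
proof -
  have "fps_deriv (nonlonely_fps ^ Suc k) =
     fps_const (real (Suc k)) * (nonlonely_fps ^ Suc k - (1 - fps_X) * nonlonely_fps ^ k)"
    unfolding deriv_power_nonlonely_fps deriv_nonlonely_fps by (simp add: algebra_simps)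
  then have "fps_nth (fps_deriv (nonlonely_fps ^ Suc k)) n =
     fps_nth (fps_const (real (Suc k)) * (nonlonely_fps ^ Suc k - (1 - fps_X) * nonlonely_fps ^ k)) n"
    by simp
  then show ?thesis
    by (simp add: nl_coeff_def nl_diff_def del: power_Suc of_nat_Suc)
qed

text \<open>Apply \<open>x d/dx\<close> to the power: it multiplies the coefficient of index
  \<open>n\<close> by \<open>n\<close>, while by the chain rule it acts on one of
  \<open>Suc k\<close> equal factors.\<close>

lemma nl_coeff_mult_index:
  "real n * nl_coeff (Suc k) n =
     real (Suc k) * (\<Sum>i\<le>n. real (n - i) * (nl_coeff k i * fps_nth nonlonely_fps (n - i)))"
proof -
  have "fps_X * fps_deriv (nonlonely_fps ^ Suc k) =
     fps_const (real (Suc k)) * (nonlonely_fps ^ k * (fps_X * fps_deriv nonlonely_fps))"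
    unfolding deriv_power_nonlonely_fps by (simp add: mult_ac)
  then have "fps_nth (fps_X * fps_deriv (nonlonely_fps ^ Suc k)) n =
     fps_nth (fps_const (real (Suc k)) * (nonlonely_fps ^ k * (fps_X * fps_deriv nonlonely_fps))) n"
    by (rule arg_cong)
  moreover have X: "fps_nth (fps_X * fps_deriv f) i = real i * fps_nth f i" for f :: "real fps" and i
    by (cases i) auto
  ultimately have "real n * nl_coeff (Suc k) n =
     real (Suc k) * fps_nth (nonlonely_fps ^ k * (fps_X * fps_deriv nonlonely_fps)) n"
    by (simp only: nl_coeff_def X fps_mult_left_const_nth)
  also have "fps_nth (nonlonely_fps ^ k * (fps_X * fps_deriv nonlonely_fps)) n =
      (\<Sum>i\<le>n. nl_coeff k i * (real (n - i) * fps_nth nonlonely_fps (n - i)))"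
    by (simp only: fps_mult_nth[of "nonlonely_fps ^ k"] nl_coeff_def X atMost_atLeast0)
  finally show ?thesis
    by (simp add: mult_ac)
qed

text \<open>All summands in \<open>nl_coeff_mult_index\<close> are nonnegative. The ones kept have
  weights \<open>2/2! = 1\<close> and \<open>3/3! = 1/2\<close>.\<close>

lemma nl_coeff_lower:
  "real (n + 2) * nl_coeff (Suc k) (n + 2) \<ge> real (Suc k) * nl_coeff k n"
  "real (n + 3) * nl_coeff (Suc k) (n + 3) \<ge> real (Suc k) * (nl_coeff k (n + 1) + nl_coeff k n / 2)"
proof -
  have nn: "0 \<le> real (m - i) * (nl_coeff k i * fps_nth nonlonely_fps (m - i))" for m i
    by (simp add: nonlonely_fps_nth nl_coeff_nonneg)
  have "(\<Sum>i\<in>{n}. real (n + 2 - i) * (nl_coeff k i * fps_nth nonlonely_fps (n + 2 - i)))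
     \<le> (\<Sum>i\<le>n+2. real (n + 2 - i) * (nl_coeff k i * fps_nth nonlonely_fps (n + 2 - i)))"
    by (rule sum_mono2[OF _ _ nn]) auto
  then have "nl_coeff k n \<le> (\<Sum>i\<le>n+2. real (n + 2 - i) * (nl_coeff k i * fps_nth nonlonely_fps (n + 2 - i)))"
    by (simp add: nonlonely_fps_nth)
  then show "real (n + 2) * nl_coeff (Suc k) (n + 2) \<ge> real (Suc k) * nl_coeff k n"
    unfolding nl_coeff_mult_index by (intro mult_left_mono) auto
  have "(\<Sum>i\<in>{n, n + 1}. real (n + 3 - i) * (nl_coeff k i * fps_nth nonlonely_fps (n + 3 - i)))
     \<le> (\<Sum>i\<le>n+3. real (n + 3 - i) * (nl_coeff k i * fps_nth nonlonely_fps (n + 3 - i)))"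
    by (rule sum_mono2[OF _ _ nn]) auto
  then have "nl_coeff k (n + 1) + nl_coeff k n / 2 \<le>
      (\<Sum>i\<le>n+3. real (n + 3 - i) * (nl_coeff k i * fps_nth nonlonely_fps (n + 3 - i)))"
    by (simp add: nonlonely_fps_nth fact_numeral)
  then show "real (n + 3) * nl_coeff (Suc k) (n + 3) \<ge> real (Suc k) * (nl_coeff k (n + 1) + nl_coeff k n / 2)"
    unfolding nl_coeff_mult_index by (intro mult_left_mono) auto
qed

lemma nl_diff_rec:
  "real (Suc n) * nl_diff (Suc k) (Suc n) = - (real n - real k) * nl_coeff (Suc k) n - real (Suc k) * nl_diff k n"
  using nl_coeff_rec[of n k] by (simp add: nl_diff_Suc algebra_simps)

section \<open>Sign of the coefficient differences\<close>

lemma nl_diff_diag: "nl_diff k k = (-1) ^ k"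
proof (induction k)
  case (Suc k)
  have "real (Suc k) * nl_diff (Suc k) (Suc k) = real (Suc k) * (- nl_diff k k)"
    using nl_diff_rec[of k k] by simp
  then have "nl_diff (Suc k) (Suc k) = - nl_diff k k"
    by (simp only: mult_left_cancel of_nat_eq_0_iff nat.distinct not_False_eq_True)
  then show ?case using Suc by simp
qed (simp add: nl_diff_0 nl_coeff_0)

text \<open>This treats the index just below the range of \<open>nl_diff_nonpos\<close>, where a
  positive value can occur (\<open>1/2\<close> at \<open>k = 1\<close>). One use of
  \<open>nl_diff_rec\<close> flips the sign, so the induction has step two.\<close>

lemma nl_diff_superdiag: "nl_diff k (Suc k) \<le> (if even k then 0 else 1 / 2)"
proof (induction k rule: induct_nat_012)
  case (ge2 k)
  have 1: "real (k + 3) * nl_diff (k + 2) (k + 3) = - nl_coeff (k + 2) (k + 2) - real (k + 2) * nl_diff (k + 1) (k + 2)"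
    using nl_diff_rec[of "k + 2" "k + 1"] by (simp add: numeral_eq_Suc)
  have 2: "real (k + 2) * nl_diff (k + 1) (k + 2) = - nl_coeff (k + 1) (k + 1) - real (k + 1) * nl_diff k (k + 1)"
    using nl_diff_rec[of "k + 1" "k"] by (simp add: numeral_eq_Suc)
  have 3: "nl_coeff (k + 1) (k + 1) = nl_coeff (k + 1) k - (-1) ^ k"
    using nl_diff_diag[of "k + 1"] nl_diff_Suc[of "k + 1" k] by simp
  have 4: "nl_coeff (k + 1) k \<le> nl_coeff (k + 2) (k + 2)"
    using nl_coeff_lower(1)[of "k + 1" k] by (simp add: numeral_eq_Suc del: of_nat_Suc of_nat_add)
  \<comment> \<open>Inserting 2 and 3 into 1 leaves the coefficients only in
    \<open>nl_coeff (k + 1) k - nl_coeff (k + 2) (k + 2)\<close>, which is nonpositive by 4.\<close>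
  have 5: "real (k + 3) * nl_diff (k + 2) (k + 3) \<le> real (k + 1) * nl_diff k (k + 1) - (-1) ^ k"
    using 1 2 3 4 by linarith
  show ?case
  proof (cases "even k")
    case True
    then have "nl_diff k (k + 1) \<le> 0" using ge2 by simp
    then have "real (k + 1) * nl_diff k (k + 1) \<le> 0" by (simp add: mult_nonneg_nonpos)
    then have "real (k + 3) * nl_diff (k + 2) (k + 3) \<le> 0" using 5 True by simp
    then have "nl_diff (k + 2) (k + 3) \<le> 0" by (simp add: mult_le_0_iff)
    then show ?thesis using True by (simp add: numeral_3_eq_3)
  next
    case False
    then have "nl_diff k (k + 1) \<le> 1 / 2" using ge2 by simp
    then have "real (k + 1) * nl_diff k (k + 1) \<le> real (k + 1) * (1 / 2)" by (intro mult_left_mono) auto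
    \<comment> \<open>For odd \<open>k\<close> the diagonal term contributes 1, and
      \<open>(k + 1)/2 + 1 = (k + 3)/2\<close>: the bound \<open>1/2\<close> reproduces
      itself.\<close>
    then have "real (k + 3) * nl_diff (k + 2) (k + 3) \<le> real (k + 3) * (1 / 2)" using 5 False
      by (simp add: algebra_simps)
    then have "nl_diff (k + 2) (k + 3) \<le> 1 / 2" by (simp only: mult_le_cancel_left_pos of_nat_0_less_iff)
    then show ?thesis using False by (simp add: numeral_3_eq_3)
  qed
qed (simp_all add: nl_diff_Suc nl_coeff_0 nl_coeff_1)

text \<open>
  Two applications of the recurrence relate \<open>nl_diff (k + 2) (n + 2)\<close> to \<open>nl_diff k n\<close> with a positive
  factor, whereas a single one reverses the sign; the induction therefore goes in steps of two.
\<close>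
lemma nl_diff_nonpos: "n \<ge> k + 2 \<Longrightarrow> nl_diff k n \<le> 0"
proof (induction k arbitrary: n rule: less_induct)
  case (less k)
  obtain m where m: "n = k + 2 + m"
    using less.prems by (auto simp: le_iff_add)
  have "k = 0 \<or> k = 1 \<or> (\<exists>l. k = l + 2)"
    by presburger
  then consider "k = 0" | "k = 1" | l where "k = l + 2"
    by blast
  then show ?case
  proof cases
    case 1
    then show ?thesis using m by (simp add: nl_diff_Suc nl_coeff_0)
  next
    case 2
    have "(fact (m + 2) :: real) \<le> fact (Suc (m + 2))" by (rule fact_mono) simp
    then have "1 / fact (Suc (m + 2)) \<le> (1 / fact (m + 2) :: real)"
      by (intro divide_left_mono) auto
    then show ?thesis using 2 m by (simp add: nl_diff_Suc nl_coeff_1 del: fact_Suc)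
  next
    case (3 l)
    define j where "j = l + m"
    have n: "n = j + 4" and jl: "j \<ge> l" using m 3 by (auto simp: j_def)
    \<comment> \<open>Only \<open>j = l\<close> escapes the induction hypothesis. There the
      difference can be as large as \<open>1/2\<close> for even \<open>l\<close>, but then the
      diagonal value \<open>-1\<close> forces \<open>nl_coeff (l + 1) l\<close> to be at least
      1.\<close>
    have small: "nl_diff (l + 1) (j + 2) \<le> nl_coeff (l + 1) j / 2"
    proof (cases "j = l")
      case False
      then have "nl_diff (l + 1) (j + 2) \<le> 0" using jl 3 by (intro less.IH) auto
      then show ?thesis using nl_coeff_nonneg[of "l + 1" j] by linarith
    next
      case j: True
      show ?thesis
      proof (cases "even l")
        case True
        have "nl_coeff (l + 1) l = nl_coeff (l + 1) (l + 1) + 1"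
          using nl_diff_diag[of "l + 1"] nl_diff_Suc[of "l + 1" l] True by simp
        then have "nl_coeff (l + 1) l \<ge> 1" using nl_coeff_nonneg[of "l + 1" "l + 1"] by linarith
        then show ?thesis using nl_diff_superdiag[of "l + 1"] True j by simp
      next
        case False
        then have "nl_diff (l + 1) (j + 2) \<le> 0" using nl_diff_superdiag[of "l + 1"] j by simp
        then show ?thesis using nl_coeff_nonneg[of "l + 1" j] by linarith
      qed
    qed
    have 1: "real (j + 4) * nl_diff (l + 2) (j + 4) =
        - (real (j + 2) - real l) * nl_coeff (l + 2) (j + 3) - real (l + 2) * nl_diff (l + 1) (j + 3)"
      using nl_diff_rec[of "j + 3" "l + 1"] by (simp add: numeral_eq_Suc)
    have 2: "real (j + 3) * nl_diff (l + 1) (j + 3) =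
        - (real (j + 2) - real l) * nl_coeff (l + 1) (j + 2) - real (l + 1) * nl_diff l (j + 2)"
      using nl_diff_rec[of "j + 2" "l"] by (simp add: numeral_eq_Suc)
    have "nl_diff (l + 1) (j + 2) = nl_coeff (l + 1) (j + 2) - nl_coeff (l + 1) (j + 1)"
      using nl_diff_Suc[of "l + 1" "j + 1"] by (simp add: numeral_eq_Suc)
    then have "nl_coeff (l + 1) (j + 2) \<le> nl_coeff (l + 1) (j + 1) + nl_coeff (l + 1) j / 2" using small by linarith
    then have "real (l + 2) * nl_coeff (l + 1) (j + 2) \<le> real (l + 2) * (nl_coeff (l + 1) (j + 1) + nl_coeff (l + 1) j / 2)"
      by (intro mult_left_mono) auto
    also have "\<dots> \<le> real (j + 3) * nl_coeff (l + 2) (j + 3)"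
      using nl_coeff_lower(2)[of "l + 1" j] by (simp del: of_nat_add of_nat_Suc)
    finally have 3: "0 \<le> real (j + 3) * nl_coeff (l + 2) (j + 3) - real (l + 2) * nl_coeff (l + 1) (j + 2)"
      by simp
    have 4: "nl_diff l (j + 2) \<le> 0" using jl \<open>k = l + 2\<close> by (intro less.IH) auto
    \<comment> \<open>The factor \<open>j + 3\<close> allows 2 to be inserted; the coefficient terms
      then group into the bracket of 3.\<close>
    have "real (j + 3) * (real (j + 4) * nl_diff (l + 2) (j + 4)) =
        - (real (j + 2) - real l) * (real (j + 3) * nl_coeff (l + 2) (j + 3))
        - real (l + 2) * (real (j + 3) * nl_diff (l + 1) (j + 3))"
      unfolding 1 by (simp only: right_diff_distrib mult_ac)
    also have "\<dots> = - ((real (j + 2) - real l) *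
          (real (j + 3) * nl_coeff (l + 2) (j + 3) - real (l + 2) * nl_coeff (l + 1) (j + 2)))
        + (real (l + 2) * real (l + 1)) * nl_diff l (j + 2)"
      unfolding 2 by algebra
    also have "\<dots> \<le> 0"
    proof -
      have "0 \<le> (real (j + 2) - real l) *
          (real (j + 3) * nl_coeff (l + 2) (j + 3) - real (l + 2) * nl_coeff (l + 1) (j + 2))"
        using 3 jl by (intro mult_nonneg_nonneg) auto
      moreover have "(real (l + 2) * real (l + 1)) * nl_diff l (j + 2) \<le> 0"
        using 4 by (intro mult_nonneg_nonpos) auto
      ultimately show ?thesis by linarith
    qed
    finally have "nl_diff (l + 2) (j + 4) \<le> 0" by (simp add: mult_le_0_iff)
    then show ?thesis using n \<open>k = l + 2\<close> by simp
  qed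
qed

text \<open>The \<open>q n k\<close> of the overview; this meaning is justified only in
  \<open>lonely_prob_eq\<close>.\<close>

definition nl_prob :: "nat \<Rightarrow> nat \<Rightarrow> real" where
  "nl_prob n k = fact n * nl_coeff k n / real k ^ n"

text \<open>By \<open>nl_coeff_rec\<close> the increment is a negative multiple of
  \<open>nl_diff k n\<close>, with exponent one below the number of buses.\<close>

lemma nl_prob_mono_step:
  assumes "n \<ge> k + 2"
  shows "nl_prob n (Suc k) \<le> nl_prob (Suc n) (Suc k)"
proof -
  have "real (Suc k) * nl_coeff (Suc k) n \<le> real (Suc n) * nl_coeff (Suc k) (Suc n)"
    unfolding nl_coeff_rec using nl_diff_nonpos[OF assms] by (intro mult_left_mono) auto
  then have "fact n * (real (Suc k) * nl_coeff (Suc k) n) / real (Suc k) ^ Suc n \<le>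
     fact n * (real (Suc n) * nl_coeff (Suc k) (Suc n)) / real (Suc k) ^ Suc n"
    by (intro divide_right_mono mult_left_mono) auto
  then show ?thesis
    by (simp add: nl_prob_def mult_ac del: of_nat_Suc)
qed

lemma nl_prob_mono:
  assumes "k \<ge> 1" "k < i" "i \<le> n"
  shows "nl_prob i k \<le> nl_prob n k"
  using assms(3)
proof (induction n rule: dec_induct)
  case (step n)
  have "nl_prob n k \<le> nl_prob (Suc n) k"
    using nl_prob_mono_step[of "k - 1" n] assms step by simp
  then show ?case using step by linarith
qed simp

lemma nl_coeff_at_0: "nl_coeff k 0 = 1"
  by (induction k) (simp_all add: nl_coeff_0 nl_coeff_Suc nonlonely_fps_nth)

lemma nl_coeff_pos:
  assumes "k \<ge> 1" "n \<ge> 2"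
  shows "nl_coeff k n > 0"
proof -
  obtain l where k: "k = Suc l"
    using assms(1) by (cases k) auto
  have "0 < (\<Sum>i\<in>{0}. nl_coeff l i * fps_nth nonlonely_fps (n - i))"
    using assms(2) by (simp add: nl_coeff_at_0 nonlonely_fps_nth)
  also have "\<dots> \<le> (\<Sum>i\<le>n. nl_coeff l i * fps_nth nonlonely_fps (n - i))"
    by (rule sum_mono2) (auto simp: nl_coeff_nonneg nonlonely_fps_nth)
  finally show ?thesis
    by (simp add: k nl_coeff_Suc)
qed

subsection \<open>The tail of the binomial distribution\<close>

text \<open>\<open>tail_small\<close> comes down to this. The induction step needs
  \<open>(k + 1)(2k - p) - k(2k + 1 - p) = k - p\<close> to be nonnegative, which is where the range
  of \<open>p\<close> enters.\<close>

lemma two_power_bound: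
  assumes "k \<ge> 1" "p \<le> k + 1"
  shows "2 * real k ^ Suc p < (real k + 1) ^ p * (2 * real k + 1 - real p)"
  using assms(2)
proof (induction p)
  case (Suc p)
  have "2 * real k ^ Suc (Suc p) = real k * (2 * real k ^ Suc p)"
    by simp
  also have "\<dots> < real k * ((real k + 1) ^ p * (2 * real k + 1 - real p))"
    using Suc assms(1) by (intro mult_strict_left_mono) auto
  also have "\<dots> = (real k + 1) ^ p * (real k * (2 * real k + 1 - real p))"
    by (simp only: mult_ac)
  also have "\<dots> \<le> (real k + 1) ^ p * ((real k + 1) * (2 * real k - real p))"
    using Suc.prems by (intro mult_left_mono) (simp_all add: algebra_simps)
  finally show ?case
    by (simp add: mult_ac)
qed simp

text \<open>Counts the boardings of \<open>k + 1\<close> buses in which exactly \<open>i\<close> passengers avoid the last bus.\<close>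
definition bin_weight :: "nat \<Rightarrow> nat \<Rightarrow> nat \<Rightarrow> real" where
  "bin_weight n k i = real (n choose i) * real k ^ i"

lemma bin_weight_nonneg: "bin_weight n k i \<ge> 0"
  by (simp add: bin_weight_def)

lemma sum_bin_weight: "(\<Sum>i\<le>n. bin_weight n k i) = (real k + 1) ^ n"
  using binomial_ring[of "real k" 1 n] by (simp add: bin_weight_def)

text \<open>Mean of the binomial distribution: of \<open>n\<close> passengers, the last bus receives
  \<open>n/(k + 1)\<close> on average.\<close>

lemma sum_bin_weight_mult:
  "(\<Sum>i\<le>Suc p. (real (Suc p) - real i) * bin_weight (Suc p) k i) =
    real (Suc p) * (real k + 1) ^ p"
proof -
  have "(real (Suc p) - real i) * bin_weight (Suc p) k i = real (Suc p) * bin_weight p k i" if "i \<le> p" for i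
  proof -
    have "real ((Suc p - i) * (Suc p choose i)) = real (Suc p * (p choose i))"
      using binomial_absorb_comp[of "Suc p" i] by simp
    then have "(real (Suc p) - real i) * real (Suc p choose i) = real (Suc p) * real (p choose i)"
      using that by (simp only: of_nat_mult) (simp add: of_nat_diff)
    then show ?thesis
      by (simp add: bin_weight_def flip: mult.assoc del: of_nat_Suc)
  qed
  then have "(\<Sum>i\<le>p. (real (Suc p) - real i) * bin_weight (Suc p) k i) = real (Suc p) * (\<Sum>i\<le>p. bin_weight p k i)"
    by (simp add: sum_distrib_left del: of_nat_Suc)
  then show ?thesis
    by (simp add: sum_bin_weight del: of_nat_Suc)
qed

text \<open>Total mass and mean evaluate the sum over all \<open>i\<close>. Its nonzero terms
  outside the tail are those at \<open>p + 1\<close> and \<open>p + 2\<close>, the latter being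
  \<open>- 2 k^(p + 2)\<close>.\<close>

lemma tail_small:
  assumes "k \<ge> 1" "p \<le> k"
  shows "(\<Sum>i<p. (real p - real i) * bin_weight (p + 2) k i) < bin_weight (p + 2) k (p + 1)"
proof -
  have "(\<Sum>i\<le>p+2. (real p - real i) * bin_weight (p + 2) k i) =
      (\<Sum>i\<le>Suc (p + 1). (real (Suc (p + 1)) - real i) * bin_weight (Suc (p + 1)) k i)
        - 2 * (\<Sum>i\<le>p+2. bin_weight (p + 2) k i)"
    by (simp add: sum_subtractf sum_distrib_left flip: sum_subtractf)
       (simp add: algebra_simps)
  also have "\<dots> = - ((real k + 1) ^ (p + 1) * (2 * real k + 1 - real (p + 1)))"
    unfolding sum_bin_weight_mult sum_bin_weight by (simp add: algebra_simps)
  also have "\<dots> < - (2 * real k ^ (p + 2))"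
    using two_power_bound[of k "p + 1"] assms by simp
  finally have "(\<Sum>i\<le>p+2. (real p - real i) * bin_weight (p + 2) k i) < - (2 * real k ^ (p + 2))" .
  then show ?thesis
    by (simp add: bin_weight_def flip: lessThan_Suc_atMost)
qed

text \<open>Starting from \<open>tail_small\<close> at \<open>p = k\<close>, each increment of
  \<open>n\<close> multiplies the left side by at most \<open>k\<close> and the right side by at
  least \<open>k\<close>.\<close>

lemma tail_large:
  assumes "k \<ge> 1" "k + 2 \<le> n"
  shows "(\<Sum>i<k. (real k - real i) * bin_weight n k i) < (real n - 1 - real k) * bin_weight n k (n - 1)"
  using assms(2)
proof (induction n rule: dec_induct)
  case base
  show ?case using tail_small[of k k] assms(1) by simp
next
  case (step n)
  have step_le: "bin_weight (Suc n) k i \<le> real k * bin_weight n k i" if "i < k" for i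
  proof -
    \<comment> \<open>The ratio of \<open>Suc n choose i\<close> to \<open>n choose i\<close> is
      \<open>(n + 1)/(n + 1 - i)\<close>, so this bounds it by \<open>k\<close>.\<close>
    have "Suc n \<le> k * (Suc n - i)"
    proof -
      obtain c where c: "n = k + 2 + c" using step by (auto simp: le_iff_add)
      have "Suc n \<le> k * (c + 4)" using assms(1) c by (cases k) (auto simp: algebra_simps)
      also have "\<dots> \<le> k * (Suc n - i)" using that c by (intro mult_left_mono) auto
      finally show ?thesis .
    qed
    have "(Suc n - i) * (Suc n choose i) = Suc n * (n choose i)"
      using binomial_absorb_comp[of "Suc n" i] by simp
    also have "\<dots> \<le> k * (Suc n - i) * (n choose i)"
      using \<open>Suc n \<le> k * (Suc n - i)\<close> by (rule mult_right_mono) simp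
    finally have "(Suc n - i) * (Suc n choose i) \<le> (Suc n - i) * (k * (n choose i))"
      by (simp add: mult_ac)
    then have "(Suc n choose i) \<le> k * (n choose i)"
      using that step by simp
    then have "real (Suc n choose i) \<le> real k * real (n choose i)"
      by (simp flip: of_nat_mult)
    then show ?thesis
      unfolding bin_weight_def mult.assoc[symmetric] by (rule mult_right_mono) simp
  qed
  have "(\<Sum>i<k. (real k - real i) * bin_weight (Suc n) k i) \<le> (\<Sum>i<k. (real k - real i) * (real k * bin_weight n k i))"
    using step_le by (intro sum_mono mult_left_mono) auto
  also have "\<dots> = real k * (\<Sum>i<k. (real k - real i) * bin_weight n k i)"
    by (simp add: sum_distrib_left mult_ac)
  also have "\<dots> < real k * ((real n - 1 - real k) * bin_weight n k (n - 1))"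
    using step assms(1) by (intro mult_strict_left_mono) auto
  also have "\<dots> = ((real n - 1 - real k) * real n) * real k ^ n"
    using step by (cases n) (simp_all add: bin_weight_def del: of_nat_Suc)
  also have "\<dots> \<le> ((real n - real k) * real (Suc n)) * real k ^ n"
    using step by (intro mult_right_mono mult_mono) auto
  also have "\<dots> = (real (Suc n) - 1 - real k) * bin_weight (Suc n) k (Suc n - 1)"
    by (simp add: bin_weight_def)
  finally show ?case .
qed

subsection \<open>Comparing \<open>k\<close> and \<open>k + 1\<close> buses\<close>

lemma bin_weight_mult_nl_prob:
  assumes "k \<ge> 1" "i \<le> n"
  shows "bin_weight n k i * nl_prob i k = fact n * nl_coeff k i / fact (n - i)"
  using assms by (simp add: bin_weight_def nl_prob_def binomial_fact)

lemma nl_prob_pos: "k \<ge> 1 \<Longrightarrow> n \<ge> 2 \<Longrightarrow> nl_prob n k > 0"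
  by (simp add: nl_prob_def nl_coeff_pos)

lemma nl_prob_nonneg: "nl_prob n k \<ge> 0"
  by (simp add: nl_prob_def nl_coeff_nonneg)

text \<open>For \<open>n \<ge> 1\<close> this restricts the count of \<open>bin_weight\<close> to
  boardings with nobody lonely; \<open>i = n - 1\<close> would leave a single passenger on the last
  bus.\<close>

definition nl_weight :: "nat \<Rightarrow> nat \<Rightarrow> nat \<Rightarrow> real" where
  "nl_weight n k i = (if i = n - 1 then 0 else bin_weight n k i * nl_prob i k)"

lemma nl_weight_eq:
  assumes "k \<ge> 1" "n \<ge> 1" "i \<le> n"
  shows "nl_weight n k i = fact n * (nl_coeff k i * fps_nth nonlonely_fps (n - i))"
proof -
  have "n - i = 1 \<longleftrightarrow> i = n - 1" using assms by auto
  then show ?thesis using assms by (simp add: nl_weight_def bin_weight_mult_nl_prob nonlonely_fps_nth)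
qed

lemma sum_nl_weight:
  assumes "k \<ge> 1" "n \<ge> 1"
  shows "(\<Sum>i\<le>n. nl_weight n k i) = (real k + 1) ^ n * nl_prob n (Suc k)"
proof -
  have "(\<Sum>i\<le>n. nl_weight n k i) = fact n * nl_coeff (Suc k) n"
    using assms by (simp add: nl_weight_eq nl_coeff_Suc sum_distrib_left)
  also have "\<dots> = (real k + 1) ^ n * nl_prob n (Suc k)"
    by (simp add: nl_prob_def add_ac)
  finally show ?thesis .
qed

text \<open>Symmetry of the buses: conditioning on nobody being lonely preserves the mean from
  \<open>sum_bin_weight_mult\<close>. The symmetry enters through the factor \<open>Suc k\<close> in
  \<open>nl_coeff_mult_index\<close>.\<close>

lemma sum_nl_weight_mult:
  assumes "k \<ge> 1"
  shows "(\<Sum>i\<le>Suc p. (real (Suc p) - real i) * nl_weight (Suc p) k i) =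
    real (Suc p) * (real k + 1) ^ p * nl_prob (Suc p) (Suc k)"
proof -
  have "(\<Sum>i\<le>Suc p. (real (Suc p) - real i) * nl_weight (Suc p) k i) =
     fact (Suc p) * (\<Sum>i\<le>Suc p. real (Suc p - i) * (nl_coeff k i * fps_nth nonlonely_fps (Suc p - i)))"
    unfolding sum_distrib_left using assms
    by (intro sum.cong) (simp_all add: nl_weight_eq of_nat_diff mult_ac)
  also have "real (Suc k) * \<dots> = fact (Suc p) * (real (Suc p) * nl_coeff (Suc k) (Suc p))"
    unfolding nl_coeff_mult_index by (simp only: mult_ac)
  also have "\<dots> = real (Suc k) * (real (Suc p) * (real k + 1) ^ p * nl_prob (Suc p) (Suc k))"
    by (simp add: nl_prob_def add_ac)
  finally show ?thesis
    by simp
qed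

text \<open>Here \<open>s\<close> is the zero of the affine test function. The index
  \<open>n - 1\<close> can be left out of the monotonicity condition because
  \<open>nl_weight\<close> vanishes there.\<close>

lemma nl_prob_less_criterion:
  assumes "k \<ge> 1" and s: "s + 2 \<le> n"
    and mono: "\<And>i. s < i \<Longrightarrow> i + 2 \<le> n \<Longrightarrow> nl_prob i k \<le> nl_prob n k"
    and tail: "(\<Sum>i<s. (real s - real i) * bin_weight n k i) < (real n - 1 - real s) * bin_weight n k (n - 1)"
  shows "nl_prob n (Suc k) < nl_prob n k"
proof (rule ccontr)
  define Q where "Q = nl_prob n (Suc k)"
  assume "\<not> ?thesis"
  then have le: "nl_prob n k \<le> Q" by (simp add: Q_def)
  have Q: "Q > 0" using nl_prob_pos[of "Suc k" n] s by (simp add: Q_def)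
  obtain p where p: "n = Suc p" using s by (cases n) auto
  \<comment> \<open>\<open>g\<close> bounds the summands below from above: \<open>nl_weight\<close>
    is dropped for \<open>i < s\<close>, the value at \<open>n - 1\<close> is exact, and all other
    summands are nonpositive.\<close>
  define g where "g i = (if i < s then (real s - real i) * bin_weight n k i * Q
    else if i = n - 1 then - ((real n - 1 - real s) * bin_weight n k i * Q) else 0)" for i
  \<comment> \<open>Split \<open>i - s = (n - s) - (n - i)\<close>; both brackets vanish because
    \<open>Q\<close> is the ratio of the total masses and also of the first moments.\<close>
  have "(\<Sum>i\<le>n. (real i - real s) * (nl_weight n k i - bin_weight n k i * Q)) =
      (real n - real s) * ((\<Sum>i\<le>n. nl_weight n k i) - (\<Sum>i\<le>n. bin_weight n k i) * Q) -
      ((\<Sum>i\<le>n. (real n - real i) * nl_weight n k i) - (\<Sum>i\<le>n. (real n - real i) * bin_weight n k i) * Q)"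
    by (simp add: sum_distrib_left sum_distrib_right flip: sum_subtractf)
       (simp add: algebra_simps)
  also have "\<dots> = 0"
    using assms(1) unfolding p sum_nl_weight_mult[OF assms(1)] sum_bin_weight_mult
    by (simp add: sum_nl_weight sum_bin_weight p Q_def del: of_nat_Suc sum.atMost_Suc)
  finally have "0 = (\<Sum>i\<le>n. (real i - real s) * (nl_weight n k i - bin_weight n k i * Q))" ..
  also have "\<dots> \<le> (\<Sum>i\<le>n. g i)"
  proof (rule sum_mono)
    fix i assume i: "i \<in> {..n}"
    have u0: "nl_weight n k i \<ge> 0" by (simp add: nl_weight_def bin_weight_nonneg nl_prob_nonneg)
    consider "i < s" | "i = n - 1" | "i \<ge> s" "i \<noteq> n - 1" by linarith
    then show "(real i - real s) * (nl_weight n k i - bin_weight n k i * Q) \<le> g i"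
    proof cases
      case 1
      then have "(real i - real s) * nl_weight n k i \<le> 0" using u0 by (intro mult_nonpos_nonneg) auto
      then show ?thesis using 1 by (simp add: g_def algebra_simps)
    next
      case 2
      then have "\<not> i < s" "real i = real n - 1" using s by auto
      then show ?thesis using 2 by (simp add: g_def nl_weight_def)
    next
      case 3
      have "(real i - real s) * (nl_weight n k i - bin_weight n k i * Q) \<le> 0"
      proof (cases "i = s")
        case False
        then have "nl_prob i k \<le> nl_prob n k" using mono[of i] 3 i by (cases "i = n") auto
        then have "nl_weight n k i \<le> bin_weight n k i * Q"
          using le 3 by (simp add: nl_weight_def mult_left_mono bin_weight_nonneg)
        then show ?thesis using 3 by (intro mult_nonneg_nonpos) auto
      qed simp
      then show ?thesis using 3 by (simp add: g_def)
    qed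
  qed
  also have "(\<Sum>i\<le>n. g i) = (\<Sum>i\<in>insert (n - 1) {..<s}. g i)"
    using s by (intro sum.mono_neutral_right) (auto simp: g_def)
  also have "\<dots> = Q * ((\<Sum>i<s. (real s - real i) * bin_weight n k i) - (real n - 1 - real s) * bin_weight n k (n - 1))"
    using s by (simp add: g_def sum_distrib_left right_diff_distrib mult_ac)
  also have "\<dots> < 0"
    using tail Q by (simp add: mult_less_0_iff)
  finally show False by simp
qed

lemma nl_prob_less:
  assumes "k \<ge> 1" "n \<ge> 2"
  shows "nl_prob n (Suc k) < nl_prob n k"
proof (cases "n \<le> k + 2")
  case True
  obtain p where p: "n = p + 2" using assms(2) by (metis le_iff_add add.commute)
  show ?thesis
    \<comment> \<open>With \<open>s = n - 2\<close> the monotonicity condition is vacuous.\<close>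
    by (rule nl_prob_less_criterion[where s = p]) (use tail_small[of k p] True p assms in auto)
next
  case False
  show ?thesis
    by (rule nl_prob_less_criterion[where s = k]) (use tail_large[of k n] nl_prob_mono[of k] False assms in auto)
qed

subsection \<open>Counting boardings without a lonely passenger\<close>

text \<open>An arbitrary passenger set lets the induction on buses remove the passengers of the last
  bus; the default \<open>0\<close> agrees with \<open>boarding\<close>.\<close>

definition none_lonely :: "'a set \<Rightarrow> nat \<Rightarrow> ('a \<Rightarrow> nat) set" where
  "none_lonely S k = {f \<in> PiE_dflt S 0 (\<lambda>_. {..<k}). \<forall>i\<in>S. \<exists>j\<in>S. j \<noteq> i \<and> f j = f i}"

lemma finite_none_lonely: "finite S \<Longrightarrow> finite (none_lonely S k)"
  unfolding none_lonely_def by (intro finite_subset[OF _ finite_PiE_dflt[of S "\<lambda>_. {..<k}" 0]]) auto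

text \<open>If \<open>T\<close> is not a singleton, its members keep each other company on the last
  bus, so the only condition left concerns the other passengers on \<open>k\<close> buses.\<close>

lemma card_none_lonely_last:
  assumes "T \<subseteq> S" "card T \<noteq> 1" "finite S"
  shows "card {f \<in> none_lonely S (Suc k). {x \<in> S. f x = k} = T} = card (none_lonely (S - T) k)"
proof -
  have T: "\<exists>j\<in>T. j \<noteq> i" if "i \<in> T" for i
  proof (rule ccontr)
    assume "\<not> ?thesis"
    then have "T = {i}" using that by blast
    then show False using assms(2) by simp
  qed
  have "bij_betw (\<lambda>f x. if x \<in> T then 0 else f x)
      {f \<in> none_lonely S (Suc k). {x \<in> S. f x = k} = T} (none_lonely (S - T) k)"
  proof (rule bij_betw_byWitness[where f' = "\<lambda>g x. if x \<in> T then k else g x"])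
    show "(\<lambda>f x. if x \<in> T then 0 else f x) `
        {f \<in> none_lonely S (Suc k). {x \<in> S. f x = k} = T} \<subseteq> none_lonely (S - T) k"
    proof (rule image_subsetI)
      fix f assume "f \<in> {f \<in> none_lonely S (Suc k). {x \<in> S. f x = k} = T}"
      then have f: "f \<in> none_lonely S (Suc k)" and T_eq: "x \<in> T \<longleftrightarrow> x \<in> S \<and> f x = k" for x
        by auto
      have "(\<lambda>x. if x \<in> T then 0 else f x) \<in> PiE_dflt (S - T) 0 (\<lambda>_. {..<k})"
        using f by (auto simp: none_lonely_def PiE_dflt_def T_eq less_Suc_eq)
      moreover have "\<exists>j\<in>S - T. j \<noteq> i \<and> (if j \<in> T then 0 else f j) = (if i \<in> T then 0 else f i)"
        if i: "i \<in> S - T" for i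
      proof -
        obtain j where "j \<in> S" "j \<noteq> i" "f j = f i"
          using f i by (auto simp: none_lonely_def)
        then show ?thesis using i by (intro bexI[of _ j]) (simp_all add: T_eq)
      qed
      ultimately show "(\<lambda>x. if x \<in> T then 0 else f x) \<in> none_lonely (S - T) k"
        by (simp add: none_lonely_def)
    qed
    show "(\<lambda>g x. if x \<in> T then k else g x) ` none_lonely (S - T) k \<subseteq>
        {f \<in> none_lonely S (Suc k). {x \<in> S. f x = k} = T}"
    proof (rule image_subsetI)
      fix g assume g: "g \<in> none_lonely (S - T) k"
      let ?f = "\<lambda>x. if x \<in> T then k else g x"
      have "?f \<in> PiE_dflt S 0 (\<lambda>_. {..<Suc k})"
        using g assms(1) by (auto simp: none_lonely_def PiE_dflt_def less_Suc_eq)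
      moreover have "\<exists>j\<in>S. j \<noteq> i \<and> ?f j = ?f i" if i: "i \<in> S" for i
      proof (cases "i \<in> T")
        case True
        then obtain j where "j \<in> T" "j \<noteq> i" using T by blast
        then show ?thesis using True assms(1) by (intro bexI[of _ j]) auto
      next
        case False
        then obtain j where "j \<in> S - T" "j \<noteq> i" "g j = g i"
          using g i by (auto simp: none_lonely_def)
        then show ?thesis using False by (intro bexI[of _ j]) auto
      qed
      ultimately have "?f \<in> none_lonely S (Suc k)"
        by (simp add: none_lonely_def)
      moreover have "g x < k" if "x \<in> S" "x \<notin> T" for x
        using g that by (simp add: none_lonely_def PiE_dflt_def)
      then have "{x \<in> S. ?f x = k} = T"
        using assms(1) by (auto split: if_splits)
      ultimately show "?f \<in> {f \<in> none_lonely S (Suc k). {x \<in> S. f x = k} = T}"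
        by blast
    qed
    show "\<forall>f\<in>{f \<in> none_lonely S (Suc k). {x \<in> S. f x = k} = T}.
        (\<lambda>x. if x \<in> T then k else if x \<in> T then 0 else f x) = f"
      by (intro ballI ext) auto
    show "\<forall>g\<in>none_lonely (S - T) k. (\<lambda>x. if x \<in> T then 0 else if x \<in> T then k else g x) = g"
      by (intro ballI ext) (simp add: none_lonely_def PiE_dflt_def)
  qed
  then show ?thesis by (rule bij_betw_same_card)
qed

lemma sum_Pow_card:
  fixes h :: "nat \<Rightarrow> real"
  assumes "finite S"
  shows "(\<Sum>T\<in>Pow S. h (card T)) = (\<Sum>j\<le>card S. real (card S choose j) * h j)"
proof -
  have "(\<Sum>T\<in>Pow S. h (card T)) = (\<Sum>j\<le>card S. \<Sum>T\<in>{T \<in> Pow S. card T = j}. h (card T))"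
    using assms by (intro sum.group[symmetric]) (auto intro: card_mono)
  also have "\<dots> = (\<Sum>j\<le>card S. real (card S choose j) * h j)"
    using n_subsets[OF assms] by (intro sum.cong) (auto simp: Pow_def)
  finally show ?thesis .
qed

text \<open>Sorting boardings by the set \<open>T\<close> on the last bus gives a binomial
  convolution, that is, a product of exponential generating functions. Singletons \<open>T\<close>
  contribute nothing, matching the missing linear term of \<open>nonlonely_fps\<close>.\<close>

lemma card_none_lonely:
  "finite S \<Longrightarrow> real (card (none_lonely S k)) = fact (card S) * nl_coeff k (card S)"
proof (induction k arbitrary: S)
  case 0
  show ?case
  proof (cases "S = {}")
    case True
    then have "none_lonely S 0 = {\<lambda>_. 0}"
      by (auto simp: none_lonely_def PiE_dflt_def)
    then show ?thesis using True by (simp add: nl_coeff_0)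
  next
    case False
    then have "none_lonely S 0 = {}"
      by (auto simp: none_lonely_def PiE_dflt_def)
    then show ?thesis using False 0 by (simp add: nl_coeff_0)
  qed
next
  case (Suc k)
  let ?n = "card S"
  let ?F = "\<lambda>T. {f \<in> none_lonely S (Suc k). {x \<in> S. f x = k} = T}"
  let ?h = "\<lambda>j. fact (?n - j) * (if j = 1 then 0 else nl_coeff k (?n - j))"
  have F: "real (card (?F T)) = ?h (card T)" if T: "T \<subseteq> S" for T
  proof (cases "card T = 1")
    case True
    then obtain t where t: "T = {t}" by (auto simp: card_1_singleton_iff)
    have empty: "?F T = {}"
    proof (rule ccontr)
      assume "?F T \<noteq> {}"
      then obtain f where f: "f \<in> none_lonely S (Suc k)" "{x \<in> S. f x = k} = {t}"
        using t by blast
      then have "t \<in> S" "f t = k" by auto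
      then obtain j where "j \<in> S" "j \<noteq> t" "f j = k" using f by (fastforce simp: none_lonely_def)
      then show False using f by blast
    qed
    show ?thesis unfolding empty using True by simp
  next
    case False
    have "card (S - T) = ?n - card T"
      using T Suc.prems by (intro card_Diff_subset) (auto intro: finite_subset)
    then show ?thesis
      using Suc.IH[of "S - T"] False card_none_lonely_last[OF T False Suc.prems] Suc.prems
      by simp
  qed
  have "(\<Union>T\<in>Pow S. ?F T) = none_lonely S (Suc k)" by auto
  moreover have "card (\<Union>T\<in>Pow S. ?F T) = (\<Sum>T\<in>Pow S. card (?F T))"
    using Suc.prems finite_none_lonely[of S "Suc k"] by (intro card_UN_disjoint) auto
  ultimately have "card (none_lonely S (Suc k)) = (\<Sum>T\<in>Pow S. card (?F T))"
    by (simp only:)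
  then have "real (card (none_lonely S (Suc k))) = (\<Sum>T\<in>Pow S. ?h (card T))"
    using F by simp
  also have "\<dots> = (\<Sum>j\<le>?n. real (?n choose j) * ?h j)"
    by (rule sum_Pow_card[OF Suc.prems])
  also have "\<dots> = (\<Sum>j\<le>?n. fact ?n * (nl_coeff k (?n - j) * fps_nth nonlonely_fps j))"
    by (intro sum.cong) (auto simp: nonlonely_fps_nth binomial_fact)
  also have "\<dots> = fact ?n * (\<Sum>j\<le>?n. nl_coeff k (?n - j) * fps_nth nonlonely_fps j)"
    by (simp add: sum_distrib_left)
  also have "(\<Sum>j\<le>?n. nl_coeff k (?n - j) * fps_nth nonlonely_fps j) = nl_coeff (Suc k) ?n"
    unfolding nl_coeff_Suc by (rule sum.reindex_bij_witness[of _ "\<lambda>i. ?n - i" "\<lambda>i. ?n - i"]) auto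
  finally show ?case .
qed

text \<open>A product of uniform distributions is uniform on the \<open>k^n\<close> boardings, so
  the complementary event can be counted.\<close>

lemma lonely_prob_eq:
  assumes "k \<ge> 1"
  shows "lonely_prob n k 1 = 1 - nl_prob n k"
proof -
  let ?P = "PiE_dflt {..<n} 0 (\<lambda>_. {..<k})"
  have fin: "finite ?P" by (rule finite_PiE_dflt) auto
  have card: "card ?P = k ^ n" by (subst card_PiE_dflt) auto
  then have ne: "?P \<noteq> {}" using assms by (metis card.empty not_one_le_zero power_eq_0_iff)
  have eq: "boarding n k = pmf_of_set ?P"
    unfolding boarding_def using assms by (intro Pi_pmf_of_set) (auto simp: lessThan_empty_iff)
  have "{f. num_lonely n f \<ge> 1} = {f. \<exists>i. lonely n f i}"
  proof -
    have "finite {i. lonely n f i}" for f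
      by (rule finite_subset[of _ "{..<n}"]) (auto simp: lonely_def)
    then show ?thesis by (auto simp: num_lonely_def Suc_le_eq card_gt_0_iff)
  qed
  then have "?P \<inter> {f. num_lonely n f \<ge> 1} = ?P - none_lonely {..<n} k"
    by (auto simp: none_lonely_def lonely_def)
  moreover have sub: "none_lonely {..<n} k \<subseteq> ?P" by (auto simp: none_lonely_def)
  ultimately have "card (?P \<inter> {f. num_lonely n f \<ge> 1}) = card ?P - card (none_lonely {..<n} k)"
    by (simp add: card_Diff_subset finite_none_lonely)
  moreover have "card (none_lonely {..<n} k) \<le> card ?P" by (rule card_mono[OF fin sub])
  ultimately show ?thesis
    unfolding lonely_prob_def eq measure_pmf_of_set[OF ne fin]
    using assms by (simp add: card card_none_lonely nl_prob_def of_nat_diff diff_divide_distrib)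
qed

theorem theorem1:
  fixes n k :: nat
  assumes "n \<ge> 2" and "k \<ge> 1"
  shows "lonely_prob n (k + 1) 1 > lonely_prob n k 1"
  using nl_prob_less[OF assms(2,1)] lonely_prob_eq[of k n] lonely_prob_eq[of "k + 1" n] assms(2) by simp

end
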